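(* Let $\Omega$ be a finite set with $|\Omega|\ge2$ and let $P=(p(x,y))_{x,y\in\Omega}$ be an irreducible Markov kernel on $\Omega$, reversible with respect to its stationary distribution $\pi$. Let $\lambda\in(-1,1)$ be an eigenvalue of $P$. Then, for every integer $n\ge2$, $$\operatorname{Gap}(\widetilde P_n)\le\frac{1-\lambda^n}{\,n\frac{1+\lambda}{1-\lambda}-\frac{2\lambda(1-\lambda^n)}{(1-\lambda)^2}\,},$$ where $\widetilde P_n$ is the resampled sliding-window count kernel of window length $n$ associated with $P$.
   Context: Reversibility means $\pi(x)p(x,y)=\pi(y)p(y,x)$ for all $x,y$; $P$ acts on functions by $(Pf)(x)=\sum_y p(x,y)f(y)$. Path law: for $u=(u_1,\dots,u_n)\in\Omega^n$, $\mu_n(u)=\pi(u_1)\prod_{i=1}^{n-1}p(u_i,u_{i+1})$. Counts: $N(u)=(N_x(u))_{x\in\Omega}$ with $N_x(u)=\#\{1\le i\le n:u_i=x\}$; $\Omega_n^{\#}=\{\eta\in\mathbb N^{\Omega}:\sum_x\eta_x=n\}$ (with $0\in\mathbb N$). The count law is $\widetilde\mu_n(\eta)=\sum_{u:N(u)=\eta}\mu_n(u)$, and $\Omega_{n,+}^{\#}=\{\eta\in\Omega_n^{\#}:\widetilde\mu_n(\eta)>0\}$. Let $e_x$ denote the unit vector at coordinate $x$ in $\mathbb N^\Omega$. Count kernel on $\Omega_{n,+}^{\#}$: $$\widetilde P_n(\eta,\xi)=\frac1{\widetilde\mu_n(\eta)}\sum_{u\in\Omega^n:\,N(u)=\eta}\mu_n(u)\sum_{z\in\Omega}p(u_n,z)\,\mathbf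 1_{\{\eta-e_{u_1}+e_z=\xi\}} .$$ It is reversible with respect to $\widetilde\mu_n$. Spectral gap: for a Markov kernel $K$ on a finite set $S$ reversible with respect to a probability measure $\rho$, $\mathcal E_K(f,f)=\frac12\sum_{x,y\in S}\rho(x)K(x,y)(f(y)-f(x))^2$, $\operatorname{Var}_\rho(f)$ is the variance of $f$ under $\rho$, and $\operatorname{Gap}(K)=\inf\{\mathcal E_K(f,f)/\operatorname{Var}_\rho(f): f:S\to\mathbb R,\ \operatorname{Var}_\rho(f)>0\}$. *)

theory Defs
  imports "HOL-Analysis.Analysis"
begin

section \<open>Markov kernels on a finite state space\<close>

text \<open>The state space is a finite type; a kernel is a function \<open>p\<close>
  with entries \<open>p x y\<close>.\<close>

definition markov_kernel :: "('a::finite \<Rightarrow> 'a \<Rightarrow> real) \<Rightarrow> bool" where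
  "markov_kernel p \<longleftrightarrow> (\<forall>x y. 0 \<le> p x y) \<and> (\<forall>x. (\<Sum>y\<in>UNIV. p x y) = 1)"

primrec kernel_pow :: "('a::finite \<Rightarrow> 'a \<Rightarrow> real) \<Rightarrow> nat \<Rightarrow> 'a \<Rightarrow> 'a \<Rightarrow> real" where
  "kernel_pow p 0 x y = of_bool (x = y)"
| "kernel_pow p (Suc m) x y = (\<Sum>z\<in>UNIV. p x z * kernel_pow p m z y)"

definition irreducible_kernel :: "('a::finite \<Rightarrow> 'a \<Rightarrow> real) \<Rightarrow> bool" where
  "irreducible_kernel p \<longleftrightarrow> (\<forall>x y. \<exists>m. 0 < kernel_pow p m x y)"

definition stationary_distribution ::
    "('a::finite \<Rightarrow> real) \<Rightarrow> ('a \<Rightarrow> 'a \<Rightarrow> real) \<Rightarrow> bool" where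
  "stationary_distribution \<pi> p \<longleftrightarrow>
     (\<forall>x. 0 \<le> \<pi> x) \<and> (\<Sum>x\<in>UNIV. \<pi> x) = 1 \<and> (\<forall>y. (\<Sum>x\<in>UNIV. \<pi> x * p x y) = \<pi> y)"

definition reversible_kernel ::
    "('a::finite \<Rightarrow> real) \<Rightarrow> ('a \<Rightarrow> 'a \<Rightarrow> real) \<Rightarrow> bool" where
  "reversible_kernel \<pi> p \<longleftrightarrow> (\<forall>x y. \<pi> x * p x y = \<pi> y * p y x)"

definition kernel_op :: "('a::finite \<Rightarrow> 'a \<Rightarrow> real) \<Rightarrow> ('a \<Rightarrow> real) \<Rightarrow> 'a \<Rightarrow> real" where
  "kernel_op p f = (\<lambda>x. \<Sum>y\<in>UNIV. p x y * f y)"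

definition kernel_eigenvalue :: "('a::finite \<Rightarrow> 'a \<Rightarrow> real) \<Rightarrow> real \<Rightarrow> bool" where
  "kernel_eigenvalue p l \<longleftrightarrow> (\<exists>f. f \<noteq> (\<lambda>x. 0) \<and> kernel_op p f = (\<lambda>x. l * f x))"


section \<open>Spectral gap of a kernel on a finite set\<close>

definition dirichlet_form ::
    "'s set \<Rightarrow> ('s \<Rightarrow> real) \<Rightarrow> ('s \<Rightarrow> 's \<Rightarrow> real) \<Rightarrow> ('s \<Rightarrow> real) \<Rightarrow> real" where
  "dirichlet_form S \<rho> K f = 1/2 * (\<Sum>x\<in>S. \<Sum>y\<in>S. \<rho> x * K x y * (f y - f x)\<^sup>2)"

definition mean_on :: "'s set \<Rightarrow> ('s \<Rightarrow> real) \<Rightarrow> ('s \<Rightarrow> real) \<Rightarrow> real" where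
  "mean_on S \<rho> f = (\<Sum>x\<in>S. \<rho> x * f x)"

definition variance_on :: "'s set \<Rightarrow> ('s \<Rightarrow> real) \<Rightarrow> ('s \<Rightarrow> real) \<Rightarrow> real" where
  "variance_on S \<rho> f = (\<Sum>x\<in>S. \<rho> x * (f x - mean_on S \<rho> f)\<^sup>2)"

text \<open>Only the values of \<open>f\<close> on \<open>S\<close> matter, so quantifying over functions on the whole
  type is the same as quantifying over functions on \<open>S\<close>. The infimum is the one of the reals;
  it has its usual meaning whenever some \<open>f\<close> has positive variance.\<close>

definition spectral_gap ::
    "'s set \<Rightarrow> ('s \<Rightarrow> real) \<Rightarrow> ('s \<Rightarrow> 's \<Rightarrow> real) \<Rightarrow> real" where
  "spectral_gap S \<rho> K =
     Inf {dirichlet_form S \<rho> K f / variance_on S \<rho> f | f. variance_on S \<rho> f > 0}"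


section \<open>The resampled sliding-window count kernel\<close>

text \<open>A window \<open>u = (u\<^sub>1, \<dots>, u\<^sub>n)\<close> is a list of length \<open>n\<close>; its entries \<open>u\<^sub>1\<close>, \<open>u\<^sub>n\<close>,
  \<open>u\<^sub>i\<close> are \<open>hd u\<close>, \<open>last u\<close> and \<open>u ! (i - 1)\<close>.\<close>

definition path_law ::
    "('a::finite \<Rightarrow> real) \<Rightarrow> ('a \<Rightarrow> 'a \<Rightarrow> real) \<Rightarrow> 'a list \<Rightarrow> real" where
  "path_law \<pi> p u = \<pi> (hd u) * (\<Prod>i<length u - 1. p (u ! i) (u ! Suc i))"

definition counts :: "'a list \<Rightarrow> 'a \<Rightarrow> nat" where
  "counts u = (\<lambda>x. count_list u x)"

definition windows_with_counts :: "nat \<Rightarrow> ('a \<Rightarrow> nat) \<Rightarrow> 'a list set" where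
  "windows_with_counts n \<eta> = {u. length u = n \<and> counts u = \<eta>}"

definition count_space :: "nat \<Rightarrow> ('a::finite \<Rightarrow> nat) set" where
  "count_space n = {\<eta>. (\<Sum>x\<in>UNIV. \<eta> x) = n}"

definition count_law ::
    "('a::finite \<Rightarrow> real) \<Rightarrow> ('a \<Rightarrow> 'a \<Rightarrow> real) \<Rightarrow> nat \<Rightarrow> ('a \<Rightarrow> nat) \<Rightarrow> real" where
  "count_law \<pi> p n \<eta> = (\<Sum>u\<in>windows_with_counts n \<eta>. path_law \<pi> p u)"

definition count_space_pos ::
    "('a::finite \<Rightarrow> real) \<Rightarrow> ('a \<Rightarrow> 'a \<Rightarrow> real) \<Rightarrow> nat \<Rightarrow> ('a \<Rightarrow> nat) set" where
  "count_space_pos \<pi> p n = {\<eta> \<in> count_space n. count_law \<pi> p n \<eta> > 0}"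

definition unit_count :: "'a \<Rightarrow> 'a \<Rightarrow> nat" where
  "unit_count x = (\<lambda>y. of_bool (y = x))"

text \<open>The subtraction on \<open>nat\<close> below never truncates for \<open>n \<ge> 1\<close>: when \<open>counts u = \<eta>\<close>,
  the coordinate of \<open>\<eta>\<close> at \<open>hd u\<close> is at least 1.\<close>

definition count_kernel ::
    "('a::finite \<Rightarrow> real) \<Rightarrow> ('a \<Rightarrow> 'a \<Rightarrow> real) \<Rightarrow> nat \<Rightarrow> ('a \<Rightarrow> nat) \<Rightarrow> ('a \<Rightarrow> nat) \<Rightarrow> real" where
  "count_kernel \<pi> p n \<eta> \<xi> =
     1 / count_law \<pi> p n \<eta> *
     (\<Sum>u\<in>windows_with_counts n \<eta>. path_law \<pi> p u *
        (\<Sum>z\<in>UNIV. p (last u) z *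
           of_bool ((\<lambda>y. \<eta> y - unit_count (hd u) y + unit_count z y) = \<xi>)))"

end

theory Submission
  imports Defs
begin

text \<open>The bound is the Rayleigh quotient of one test function. If \<open>f\<close> is an eigenfunction of \<open>P\<close>
  for \<open>\<lambda>\<close>, put \<open>F(\<eta>) = \<Sum>\<^sub>x \<eta>\<^sub>x f(x)\<close>, so that \<open>F(N(u)) = f(u\<^sub>1) + \<dots> + f(u\<^sub>n)\<close>. A step of the count
  chain changes \<open>F\<close> by \<open>f(z) - f(u\<^sub>1)\<close>, where \<open>z\<close> is the point visited after the window; since
  the correlation of \<open>f\<close> at time distance \<open>k\<close> is \<open>\<lambda>\<^sup>k \<pi>(f\<^sup>2)\<close>, the Dirichlet form of \<open>F\<close> is
  \<open>(1 - \<lambda>\<^sup>n) \<pi>(f\<^sup>2)\<close>. The mean of \<open>F\<close> vanishes, and the same correlations give its variance.\<close>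

section \<open>Averages over windows by first-step analysis\<close>

text \<open>The initial weight is the constant \<open>1\<close>, so that \<open>walk_mean p n x G\<close> is the mean of \<open>G\<close> over
  the windows of length \<open>n + 1\<close> conditioned to start at \<open>x\<close>.\<close>

definition walk_mean ::
    "('a::finite \<Rightarrow> 'a \<Rightarrow> real) \<Rightarrow> nat \<Rightarrow> 'a \<Rightarrow> ('a list \<Rightarrow> real) \<Rightarrow> real" where
  "walk_mean p n x G = (\<Sum>v | length v = n. path_law (\<lambda>_. 1) p (x # v) * G (x # v))"

lemma finite_length_eq: "finite {u :: 'a::finite list. length u = n}"
  using finite_lists_length_eq[of "UNIV :: 'a set" n] by simp

lemma path_law_singleton [simp]: "path_law \<pi> p [x] = \<pi> x"
  by (simp add: path_law_def)

lemma path_law_Cons_Cons: "path_law \<pi> p (x # y # v) = \<pi> x * p x y * path_law (\<lambda>_. 1) p (y # v)"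
  by (simp add: path_law_def prod.lessThan_Suc_shift del: prod.lessThan_Suc)

lemma path_law_start: "path_law \<pi> p (x # v) = \<pi> x * path_law (\<lambda>_. 1) p (x # v)"
  by (simp add: path_law_def)

lemma path_law_nonneg:
  assumes "markov_kernel p" "stationary_distribution \<pi> p"
  shows "0 \<le> path_law \<pi> p u"
  using assms by (auto simp: path_law_def markov_kernel_def stationary_distribution_def
      intro!: mult_nonneg_nonneg prod_nonneg)

lemma sum_length_Suc:
  "(\<Sum>u | length u = Suc n. G u) = (\<Sum>x\<in>UNIV. \<Sum>v | length v = n. G (x # v))"
  for G :: "'a::finite list \<Rightarrow> real"
proof -
  have "(\<Sum>x\<in>UNIV. \<Sum>v | length v = n. G (x # v))
      = (\<Sum>(x, v)\<in>UNIV \<times> {v. length v = n}. G (x # v))"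
    by (simp add: sum.cartesian_product)
  also have "\<dots> = (\<Sum>u | length u = Suc n. G u)"
    by (rule sum.reindex_bij_witness[of _ "\<lambda>u. (hd u, tl u)" "\<lambda>(x, v). x # v"])
       (auto simp: length_Suc_conv)
  finally show ?thesis by simp
qed

text \<open>Conditioning on the first state of the window. The parameter \<open>n\<close> counts
  steps, so the windows have \<open>n + 1\<close> entries.\<close>

lemma path_law_sum:
  "(\<Sum>u | length u = Suc n. path_law \<pi> p u * G u) = (\<Sum>x\<in>UNIV. \<pi> x * walk_mean p n x G)"
  unfolding sum_length_Suc walk_mean_def sum_distrib_left
  by (intro sum.cong refl) (subst path_law_start, simp add: mult.assoc)

lemma walk_mean_0 [simp]: "walk_mean p 0 x G = G [x]"
  by (simp add: walk_mean_def)

text \<open>Markov property at the first step: the state \<open>x\<close> is absorbed into the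
  averaged function, and what remains is a walk of the same kind started at
  \<open>y\<close>.\<close>

lemma walk_mean_Suc:
  "walk_mean p (Suc n) x G = (\<Sum>y\<in>UNIV. p x y * walk_mean p n y (\<lambda>v. G (x # v)))"
  unfolding walk_mean_def sum_length_Suc sum_distrib_left
  by (simp add: path_law_Cons_Cons mult.assoc)

lemma walk_mean_add: "walk_mean p n x (\<lambda>u. G u + H u) = walk_mean p n x G + walk_mean p n x H"
  by (simp add: walk_mean_def sum.distrib algebra_simps)

lemma walk_mean_scale: "walk_mean p n x (\<lambda>u. c * G u) = c * walk_mean p n x G"
  by (simp add: walk_mean_def sum_distrib_left algebra_simps)

text \<open>All windows averaged here start with \<open>x\<close>, so the integrands need to agree
  only on those; in particular \<open>hd u\<close> may be replaced by the constant
  \<open>x\<close>.\<close>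

lemma walk_mean_cong_hd:
  assumes "\<And>v. G (x # v) = H (x # v)"
  shows "walk_mean p n x G = walk_mean p n x H"
  by (simp add: walk_mean_def assms)

lemma walk_mean_const:
  assumes "markov_kernel p"
  shows "walk_mean p n x (\<lambda>_. c) = c"
  using assms
  by (induction n arbitrary: x)
     (simp_all add: walk_mean_Suc markov_kernel_def flip: sum_distrib_right)

lemma walk_mean_last: "walk_mean p n x (\<lambda>u. h (last u)) = (kernel_op p ^^ n) h x"
proof (induction n arbitrary: x)
  case (Suc n)
  have "walk_mean p n y (\<lambda>v. h (last (x # v))) = (kernel_op p ^^ n) h y" for y
    unfolding Suc[symmetric] by (rule walk_mean_cong_hd) simp
  then show ?case
    by (simp add: walk_mean_Suc kernel_op_def[of p "(kernel_op p ^^ n) h"] del: last.simps)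
qed simp

section \<open>Invariance and positivity of \<pi>\<close>

lemma stationary_kernel_op:
  assumes "stationary_distribution \<pi> p"
  shows "(\<Sum>x\<in>UNIV. \<pi> x * kernel_op p h x) = (\<Sum>x\<in>UNIV. \<pi> x * h x)"
proof -
  have "(\<Sum>x\<in>UNIV. \<pi> x * kernel_op p h x) = (\<Sum>y\<in>UNIV. \<Sum>x\<in>UNIV. \<pi> x * p x y * h y)"
    unfolding kernel_op_def sum_distrib_left by (subst sum.swap) (simp add: mult.assoc)
  also have "\<dots> = (\<Sum>x\<in>UNIV. \<pi> x * h x)"
    using assms by (simp add: stationary_distribution_def flip: sum_distrib_right)
  finally show ?thesis .
qed

lemma stationary_kernel_op_pow:
  assumes "stationary_distribution \<pi> p"
  shows "(\<Sum>x\<in>UNIV. \<pi> x * (kernel_op p ^^ n) h x) = (\<Sum>x\<in>UNIV. \<pi> x * h x)"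
  by (induction n) (simp_all add: stationary_kernel_op[OF assms])

lemma stationary_kernel_pow:
  assumes "stationary_distribution \<pi> p"
  shows "(\<Sum>x\<in>UNIV. \<pi> x * kernel_pow p n x y) = \<pi> y"
proof (induction n)
  case (Suc n)
  have "(\<Sum>x\<in>UNIV. \<pi> x * kernel_pow p (Suc n) x y)
      = (\<Sum>x\<in>UNIV. \<pi> x * kernel_op p (\<lambda>z. kernel_pow p n z y) x)"
    by (simp add: kernel_op_def)
  then show ?case using Suc by (simp add: stationary_kernel_op[OF assms])
qed (simp add: of_bool_def if_distrib cong: if_cong)

lemma kernel_pow_nonneg: "markov_kernel p \<Longrightarrow> 0 \<le> kernel_pow p n x y"
  by (induction n arbitrary: x) (auto simp: markov_kernel_def intro!: sum_nonneg)

text \<open>Some state \<open>x\<close> carries mass because the masses sum to \<open>1\<close>.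
  Irreducibility leads from \<open>x\<close> to \<open>y\<close> in some number \<open>m\<close> of
  steps with positive probability, and invariance under \<open>m\<close> steps carries part of that
  mass to \<open>y\<close>.\<close>

lemma stationary_pos:
  assumes "markov_kernel p" "irreducible_kernel p" "stationary_distribution \<pi> p"
  shows "0 < \<pi> y"
proof -
  have nn: "0 \<le> \<pi> x" for x using assms by (simp add: stationary_distribution_def)
  have "\<exists>x. \<pi> x \<noteq> 0"
  proof (rule ccontr)
    assume "\<nexists>x. \<pi> x \<noteq> 0"
    then show False using assms(3) by (simp add: stationary_distribution_def)
  qed
  then obtain x where "0 < \<pi> x" using nn by (metis order_le_less)
  moreover obtain m where "0 < kernel_pow p m x y"
    using assms(2) by (auto simp: irreducible_kernel_def)
  ultimately have "0 < \<pi> x * kernel_pow p m x y" by simp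
  also have "\<dots> \<le> (\<Sum>x\<in>UNIV. \<pi> x * kernel_pow p m x y)"
    by (rule member_le_sum) (auto intro!: mult_nonneg_nonneg nn kernel_pow_nonneg assms)
  finally show ?thesis by (simp add: stationary_kernel_pow[OF assms(3)])
qed

section \<open>Eigenfunctions along the walk\<close>

lemma kernel_op_pow_eigen:
  assumes "kernel_op p f = (\<lambda>x. l * f x)"
  shows "(kernel_op p ^^ n) f = (\<lambda>x. l ^ n * f x)"
proof (induction n)
  case (Suc n)
  have "kernel_op p (\<lambda>x. l ^ n * f x) = (\<lambda>x. l ^ n * kernel_op p f x)"
    by (simp add: kernel_op_def sum_distrib_left algebra_simps)
  then show ?case using Suc assms by (simp add: algebra_simps)
qed simp

text \<open>Started at \<open>x\<close>, the mean of \<open>f\<close> after \<open>k\<close> steps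
  is \<open>l ^ k * f x\<close>, and the window covers the times \<open>0\<close> to
  \<open>n\<close>. The induction splits off the first entry; the eigenvalue equation shifts the
  geometric sum of the rest.\<close>

lemma walk_mean_sum_eigen:
  assumes "markov_kernel p" "kernel_op p f = (\<lambda>x. l * f x)"
  shows "walk_mean p n x (\<lambda>u. sum_list (map f u)) = (\<Sum>k\<le>n. l ^ k) * f x"
proof (induction n arbitrary: x)
  case (Suc n)
  have "walk_mean p (Suc n) x (\<lambda>u. sum_list (map f u))
      = (\<Sum>y\<in>UNIV. p x y * (f x + (\<Sum>k\<le>n. l ^ k) * f y))"
    by (simp add: walk_mean_Suc walk_mean_add walk_mean_const[OF assms(1)] Suc)
  also have "\<dots> = (\<Sum>y\<in>UNIV. p x y) * f x + (\<Sum>k\<le>n. l ^ k) * kernel_op p f x"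
    by (simp add: kernel_op_def sum_distrib_left sum_distrib_right sum.distrib algebra_simps)
  also have "\<dots> = (\<Sum>k\<le>Suc n. l ^ k) * f x"
    using assms by (subst sum.atMost_Suc_shift)
      (simp add: markov_kernel_def sum_distrib_left algebra_simps)
  finally show ?case .
qed simp

section \<open>The variance factor\<close>

text \<open>Equals \<open>\<Sum>\<^sub>i\<^sub>,\<^sub>j l\<^bsup>|i-j|\<^esup>\<close> over \<open>1 \<le> i, j \<le> n\<close> when \<open>l \<noteq> 1\<close>.\<close>

definition variance_factor :: "real \<Rightarrow> nat \<Rightarrow> real" where
  "variance_factor l n = real n * ((1 + l) / (1 - l)) - 2 * l * (1 - l ^ n) / (1 - l)\<^sup>2"

text \<open>One more index adds a diagonal entry \<open>1\<close> and twice the off-diagonal entries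
  \<open>l + ... + l ^ n\<close>, here in closed form.\<close>

lemma variance_factor_Suc:
  assumes "l \<noteq> 1"
  shows "variance_factor l (Suc n) = 1 + 2 * l * (1 - l ^ n) / (1 - l) + variance_factor l n"
proof -
  define d where "d = 1 - l"
  have d: "d \<noteq> 0" using assms by (simp_all add: d_def)
  have "variance_factor l (Suc n) - variance_factor l n
      = (1 + l) / d - 2 * l * (l ^ n * d) / d\<^sup>2"
    by (simp add: variance_factor_def d_def[symmetric] add_divide_distrib[symmetric]
       diff_divide_distrib[symmetric] algebra_simps)
       (simp add: d_def add_divide_distrib diff_divide_distrib algebra_simps)
  also have "\<dots> = 1 + 2 * l * (1 - l ^ n) / (1 - l)"
    using d unfolding d_def[symmetric]
    by (simp add: field_simps power2_eq_square) (simp add: d_def algebra_simps)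
  finally show ?thesis by simp
qed

text \<open>After multiplication by the square of \<open>1 - l\<close> and factoring out
  \<open>1 - l\<close>, the claim is that \<open>real n * (1 + l)\<close> exceeds
  \<open>2 * l\<close> times the geometric sum. For nonnegative \<open>l\<close> that sum is at most
  \<open>n\<close> and \<open>2 * l < 1 + l\<close>; for negative \<open>l\<close> it is
  nonnegative, so the product is at most zero.\<close>

lemma variance_factor_pos:
  assumes "-1 < l" "l < 1" "0 < n"
  shows "0 < variance_factor l n"
proof -
  have "(a * (b / d) - c / d\<^sup>2) * d\<^sup>2 = a * b * d - c" if "d \<noteq> 0" for a b c d :: real
    using that by (simp add: field_simps power2_eq_square)
  then have "variance_factor l n * (1 - l)\<^sup>2 = real n * (1 + l) * (1 - l) - 2 * l * (1 - l ^ n)"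
    using assms by (simp add: variance_factor_def)
  also have "\<dots> = (1 - l) * (real n * (1 + l) - 2 * l * (\<Sum>k<n. l ^ k))"
    unfolding one_diff_power_eq[of l n] by (simp add: right_diff_distrib mult_ac)
  also have "\<dots> > 0"
  proof (cases "l \<ge> 0")
    case True
    have "(\<Sum>k<n. l ^ k) \<le> (\<Sum>k<n. 1)"
      using True assms by (intro sum_mono power_le_one) auto
    then have "2 * l * (\<Sum>k<n. l ^ k) \<le> 2 * l * real n"
      using True by (intro mult_left_mono) auto
    also have "\<dots> < (1 + l) * real n"
      using assms by (intro mult_strict_right_mono) auto
    finally show ?thesis using assms by (intro mult_pos_pos) (simp_all add: mult.commute)
  next
    case False
    \<comment> \<open>For negative \<open>l\<close> the power can have either sign, so it is bounded
      through its absolute value.\<close>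
    have "0 \<le> 1 - l ^ n"
      using power_le_one_iff[of "\<bar>l\<bar>" n] assms abs_le_D1[of "l ^ n" 1] by (simp add: power_abs)
    then have "0 \<le> (\<Sum>k<n. l ^ k)"
      using one_diff_power_eq[of l n] assms by (simp add: zero_le_mult_iff)
    then have "2 * l * (\<Sum>k<n. l ^ k) \<le> 0"
      using False by (simp add: mult_nonpos_nonneg)
    moreover have "0 < real n * (1 + l)" using assms by simp
    ultimately show ?thesis using assms by (intro mult_pos_pos) linarith+
  qed
  finally show ?thesis using assms by (simp add: zero_less_mult_iff)
qed

section \<open>Quadratic means of the stationary walk\<close>

text \<open>Induction by prepending a state. Squaring \<open>f x\<close> plus the remaining sum
  yields diagonal and cross terms, which make up the increment in
  \<open>variance_factor_Suc\<close>, and a remaining square whose mean is, by stationarity, that of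
  the shorter window.\<close>

lemma stationary_walk_sum_square:
  assumes "markov_kernel p" "stationary_distribution \<pi> p" "kernel_op p f = (\<lambda>x. l * f x)"
    and "l \<noteq> 1"
  shows "(\<Sum>x\<in>UNIV. \<pi> x * walk_mean p n x (\<lambda>u. (sum_list (map f u))\<^sup>2))
     = variance_factor l (Suc n) * (\<Sum>x\<in>UNIV. \<pi> x * (f x)\<^sup>2)"
proof (induction n)
  case 0
  show ?case
    using assms(4) by (simp add: variance_factor_Suc) (simp add: variance_factor_def)
next
  case (Suc n)
  define M where "M = (\<lambda>y. walk_mean p n y (\<lambda>u. (sum_list (map f u))\<^sup>2))"
  define g where "g = (\<Sum>k\<le>n. l ^ k)"
  have step: "walk_mean p (Suc n) x (\<lambda>u. (sum_list (map f u))\<^sup>2)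
      = (1 + 2 * l * g) * (f x)\<^sup>2 + kernel_op p M x" for x
  proof -
    have "walk_mean p n y (\<lambda>u. (f x + sum_list (map f u))\<^sup>2)
        = (f x)\<^sup>2 + 2 * f x * (g * f y) + M y" for y
      by (simp add: power2_sum walk_mean_add walk_mean_scale walk_mean_const[OF assms(1)]
          walk_mean_sum_eigen[OF assms(1,3)] M_def g_def add_ac)
    then have "walk_mean p (Suc n) x (\<lambda>u. (sum_list (map f u))\<^sup>2)
        = (\<Sum>y\<in>UNIV. p x y * ((f x)\<^sup>2 + 2 * f x * (g * f y) + M y))"
      by (simp add: walk_mean_Suc)
    also have "\<dots> = (\<Sum>y\<in>UNIV. p x y) * (f x)\<^sup>2 + 2 * f x * g * kernel_op p f x + kernel_op p M x"
      by (simp add: kernel_op_def sum_distrib_left sum_distrib_right sum.distrib algebra_simps)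
    finally show ?thesis
      using assms(1) by (simp add: assms(3) markov_kernel_def power2_eq_square algebra_simps)
  qed
  have g: "g = (1 - l ^ Suc n) / (1 - l)"
    using one_diff_power_eq[of l "Suc n"] assms(4)
    unfolding g_def lessThan_Suc_atMost by (simp add: field_simps)
  have "(\<Sum>x\<in>UNIV. \<pi> x * walk_mean p (Suc n) x (\<lambda>u. (sum_list (map f u))\<^sup>2))
      = (1 + 2 * l * g) * (\<Sum>x\<in>UNIV. \<pi> x * (f x)\<^sup>2) + (\<Sum>x\<in>UNIV. \<pi> x * kernel_op p M x)"
    unfolding step by (simp add: sum_distrib_left sum.distrib algebra_simps)
  also have "(\<Sum>x\<in>UNIV. \<pi> x * kernel_op p M x)
      = variance_factor l (Suc n) * (\<Sum>x\<in>UNIV. \<pi> x * (f x)\<^sup>2)"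
    unfolding stationary_kernel_op[OF assms(2)] M_def by (rule Suc)
  finally show ?case
    unfolding variance_factor_Suc[OF assms(4), of "Suc n"] g by (simp add: algebra_simps)
qed

text \<open>Applying the kernel preserves the mean under \<pi> but also multiplies it by
  \<open>l\<close>.\<close>

lemma stationary_eigen_mean:
  assumes "stationary_distribution \<pi> p" "kernel_op p f = (\<lambda>x. l * f x)" "l \<noteq> 1"
  shows "(\<Sum>x\<in>UNIV. \<pi> x * f x) = 0"
proof -
  have "(\<Sum>x\<in>UNIV. \<pi> x * f x) = l * (\<Sum>x\<in>UNIV. \<pi> x * f x)"
    using stationary_kernel_op[OF assms(1), of f] by (simp add: assms(2) sum_distrib_left mult_ac)
  then show ?thesis using assms(3) by simp
qed

text \<open>Powers of the kernel act linearly, fix constants and multiply \<open>f\<close> by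
  \<open>l ^ n\<close>. The intended \<open>c\<close> is \<open>f x\<close>, the value at the
  starting state.\<close>

lemma kernel_op_pow_square_diff:
  assumes "markov_kernel p" "kernel_op p f = (\<lambda>x. l * f x)"
  shows "(kernel_op p ^^ n) (\<lambda>z. (f z - c)\<^sup>2) x
    = (kernel_op p ^^ n) (\<lambda>z. (f z)\<^sup>2) x - 2 * c * l ^ n * f x + c\<^sup>2"
proof -
  have "(kernel_op p ^^ n) (\<lambda>z. (f z - c)\<^sup>2) x
     = walk_mean p n x (\<lambda>u. (f (last u))\<^sup>2 + ((- 2 * c) * f (last u) + c\<^sup>2))"
    unfolding walk_mean_last[symmetric] by (simp add: power2_diff algebra_simps)
  also have "\<dots> = (kernel_op p ^^ n) (\<lambda>z. (f z)\<^sup>2) x + ((- 2 * c) * (l ^ n * f x) + c\<^sup>2)"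
    unfolding walk_mean_add walk_mean_scale walk_mean_const[OF assms(1)]
      walk_mean_last[of p n x "\<lambda>z. (f z)\<^sup>2"] walk_mean_last[of p n x f]
      kernel_op_pow_eigen[OF assms(2)] ..
  finally show ?thesis by (simp add: algebra_simps)
qed

text \<open>The window and the next state \<open>z\<close> form a walk of \<open>n + 1\<close> steps
  from \<open>hd u\<close>. Both ends have law \<pi>, which gives two second moments of
  \<open>f\<close>; the cross term carries the correlation \<open>l ^ Suc n\<close>.\<close>

lemma stationary_square_diff:
  assumes "markov_kernel p" "stationary_distribution \<pi> p" "kernel_op p f = (\<lambda>x. l * f x)"
  shows "(\<Sum>u | length u = Suc n. path_law \<pi> p u * (\<Sum>z\<in>UNIV. p (last u) z * (f z - f (hd u))\<^sup>2))
    = 2 * (1 - l ^ Suc n) * (\<Sum>x\<in>UNIV. \<pi> x * (f x)\<^sup>2)"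
proof -
  have "walk_mean p n x (\<lambda>u. \<Sum>z\<in>UNIV. p (last u) z * (f z - f (hd u))\<^sup>2)
      = (kernel_op p ^^ Suc n) (\<lambda>z. (f z)\<^sup>2) x + (1 - 2 * l ^ Suc n) * (f x)\<^sup>2" for x
  proof -
    have "walk_mean p n x (\<lambda>u. \<Sum>z\<in>UNIV. p (last u) z * (f z - f (hd u))\<^sup>2)
       = walk_mean p n x (\<lambda>u. kernel_op p (\<lambda>z. (f z - f x)\<^sup>2) (last u))"
      by (rule walk_mean_cong_hd) (simp add: kernel_op_def)
    also have "\<dots> = (kernel_op p ^^ Suc n) (\<lambda>z. (f z - f x)\<^sup>2) x"
      unfolding walk_mean_last funpow_Suc_right by simp
    finally show ?thesis
      unfolding kernel_op_pow_square_diff[OF assms(1,3)]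
      by (simp add: power2_eq_square algebra_simps del: funpow.simps)
  qed
  then have "(\<Sum>u | length u = Suc n.
        path_law \<pi> p u * (\<Sum>z\<in>UNIV. p (last u) z * (f z - f (hd u))\<^sup>2))
      = (\<Sum>x\<in>UNIV. \<pi> x * (kernel_op p ^^ Suc n) (\<lambda>z. (f z)\<^sup>2) x)
        + (1 - 2 * l ^ Suc n) * (\<Sum>x\<in>UNIV. \<pi> x * (f x)\<^sup>2)"
    unfolding path_law_sum
    by (simp only:) (simp add: sum_distrib_left sum.distrib sum_subtractf algebra_simps
      del: funpow.simps power_Suc)
  then show ?thesis
    unfolding stationary_kernel_op_pow[OF assms(2)] by (simp add: algebra_simps)
qed

section \<open>From windows to counts\<close>

lemma sum_list_map_counts: "sum_list (map f u) = (\<Sum>x\<in>UNIV. real (counts u x) * f x)"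
  for f :: "'a::finite \<Rightarrow> real"
proof (induction u)
  case (Cons a u)
  have "real (counts (a # u) x) * f x = real (counts u x) * f x + (if x = a then f x else 0)" for x
    by (simp add: counts_def algebra_simps)
  then show ?case using Cons by (simp add: sum.distrib)
qed (simp add: counts_def)

lemma sum_windows:
  "(\<Sum>\<eta>\<in>counts ` {u. length u = n}. \<Sum>u\<in>windows_with_counts n \<eta>. G u) = (\<Sum>u | length u = n. G u)"
  for G :: "'a::finite list \<Rightarrow> real"
  using sum.group[OF finite_length_eq finite_imageI[OF finite_length_eq] order_refl,
     where g = counts and h = G]
  by (simp add: windows_with_counts_def)

lemma count_space_pos_subset: "count_space_pos \<pi> p n \<subseteq> counts ` {u. length u = n}"
proof
  fix \<eta> assume "\<eta> \<in> count_space_pos \<pi> p n"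
  then have "windows_with_counts n \<eta> \<noteq> {}"
    by (auto simp: count_space_pos_def count_law_def)
  then show "\<eta> \<in> counts ` {u. length u = n}" by (auto simp: windows_with_counts_def)
qed

lemma finite_count_space_pos: "finite (count_space_pos \<pi> p n)"
  by (rule finite_subset[OF count_space_pos_subset]) (intro finite_imageI finite_length_eq)

lemma count_law_nonneg:
  assumes "markov_kernel p" "stationary_distribution \<pi> p"
  shows "0 \<le> count_law \<pi> p n \<eta>"
  unfolding count_law_def by (intro sum_nonneg path_law_nonneg assms)

lemma counts_in_count_space: "counts u \<in> count_space (length u)"
proof -
  have "real (length u) = real (\<Sum>x\<in>UNIV. counts u x)"
    using sum_list_map_counts[of "\<lambda>_. 1" u] by (simp add: sum_list_triv)
  then show ?thesis by (simp only: of_nat_eq_iff) (simp add: count_space_def)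
qed

text \<open>The count law is the image of the path law under \<open>counts\<close>. By
  nonnegativity, attained counts outside \<open>count_space_pos\<close> have weight exactly zero, so
  leaving them out loses nothing.\<close>

lemma count_law_sum:
  assumes "markov_kernel p" "stationary_distribution \<pi> p"
  shows "(\<Sum>\<eta>\<in>count_space_pos \<pi> p n. count_law \<pi> p n \<eta> * G \<eta>)
    = (\<Sum>u | length u = n. path_law \<pi> p u * G (counts u))"
proof -
  have "count_law \<pi> p n \<eta> = 0"
    if "\<eta> \<in> counts ` {u. length u = n} - count_space_pos \<pi> p n" for \<eta>
  proof -
    have "\<eta> \<in> count_space n" using that counts_in_count_space by auto
    then show ?thesis
      using that count_law_nonneg[OF assms, of n \<eta>] by (auto simp: count_space_pos_def)
  qed
  then have "(\<Sum>\<eta>\<in>count_space_pos \<pi> p n. count_law \<pi> p n \<eta> * G \<eta>)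
      = (\<Sum>\<eta>\<in>counts ` {u. length u = n}. count_law \<pi> p n \<eta> * G \<eta>)"
    by (intro sum.mono_neutral_left count_space_pos_subset finite_imageI finite_length_eq) auto
  also have "\<dots> = (\<Sum>\<eta>\<in>counts ` {u. length u = n}.
      \<Sum>u\<in>windows_with_counts n \<eta>. path_law \<pi> p u * G (counts u))"
    by (simp add: count_law_def sum_distrib_right windows_with_counts_def)
  finally show ?thesis unfolding sum_windows .
qed

text \<open>A nonempty window contains its own head, so the subtraction on naturals does not
  truncate and linearity applies.\<close>

lemma sum_slide:
  fixes f :: "'a::finite \<Rightarrow> real"
  assumes "u \<noteq> []"
  shows "(\<Sum>x\<in>UNIV. real (counts u x - unit_count (hd u) x + unit_count z x) * f x)
    = sum_list (map f u) + f z - f (hd u)"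
proof -
  have "real (counts u x - unit_count (hd u) x + unit_count z x) * f x
     = real (counts u x) * f x + (if x = z then f x else 0) - (if x = hd u then f x else 0)" for x
    using assms by (cases u) (auto simp: counts_def unit_count_def algebra_simps of_nat_diff)
  then show ?thesis
    by (simp add: sum.distrib sum_subtractf sum_list_map_counts)
qed

section \<open>Dirichlet form and spectral gap\<close>

text \<open>The count law cancels the normalisation of the kernel. Only an inequality is claimed:
  targets outside \<open>S\<close> are dropped on the left, and the left side is zero where the
  count law vanishes. This suffices to bound a Dirichlet form from above.\<close>

lemma count_law_times_kernel_le:
  assumes "markov_kernel p" "stationary_distribution \<pi> p"
    and "finite S" "\<And>\<xi>. 0 \<le> g \<xi>"
  shows "(\<Sum>\<xi>\<in>S. count_law \<pi> p n \<eta> * count_kernel \<pi> p n \<eta> \<xi> * g \<xi>)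
    \<le> (\<Sum>u\<in>windows_with_counts n \<eta>. path_law \<pi> p u * (\<Sum>z\<in>UNIV. p (last u) z *
         g (\<lambda>y. \<eta> y - unit_count (hd u) y + unit_count z y)))" (is "?L \<le> ?R")
proof -
  have p: "0 \<le> p x y" for x y using assms(1) by (simp add: markov_kernel_def)
  note \<mu> = path_law_nonneg[OF assms(1,2)]
  show ?thesis
  proof (cases "count_law \<pi> p n \<eta> = 0")
    case True
    then show ?thesis
      by (auto intro!: sum_nonneg mult_nonneg_nonneg \<mu> p assms(4))
  next
    case False
    define s where "s = (\<lambda>u z y. \<eta> y - unit_count (hd u) y + unit_count z y)"
    have "count_law \<pi> p n \<eta> * count_kernel \<pi> p n \<eta> \<xi> = (\<Sum>u\<in>windows_with_counts n \<eta>.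
        path_law \<pi> p u * (\<Sum>z\<in>UNIV. p (last u) z * of_bool (s u z = \<xi>)))" for \<xi>
      using False by (simp add: count_kernel_def s_def)
    then have "?L = (\<Sum>\<xi>\<in>S. \<Sum>u\<in>windows_with_counts n \<eta>. path_law \<pi> p u *
        (\<Sum>z\<in>UNIV. p (last u) z * (of_bool (s u z = \<xi>) * g \<xi>)))"
      by (simp only: sum_distrib_right mult.assoc)
    also have "\<dots> = (\<Sum>u\<in>windows_with_counts n \<eta>. path_law \<pi> p u *
        (\<Sum>z\<in>UNIV. p (last u) z * (\<Sum>\<xi>\<in>S. of_bool (s u z = \<xi>) * g \<xi>)))"
      unfolding sum_distrib_left
      by (subst sum.swap, rule sum.cong[OF refl], rule sum.swap)
    \<comment> \<open>The sum over \<open>S\<close> is \<open>g (s u z)\<close> if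
      \<open>s u z\<close> lies in \<open>S\<close> and \<open>0\<close> otherwise.\<close>
    also have "\<dots> \<le> ?R"
      using assms(3,4)
      by (intro sum_mono mult_left_mono \<mu> p)
         (simp add: s_def of_bool_def if_distribR if_distrib[of "\<lambda>x. x * _"] cong: if_cong)
    finally show ?thesis .
  qed
qed

text \<open>Nonnegative weights bound all Rayleigh quotients below by \<open>0\<close>, so the real
  \<open>Inf\<close> lies below each of them.\<close>

lemma spectral_gap_le:
  assumes "\<And>x y. x \<in> S \<Longrightarrow> y \<in> S \<Longrightarrow> 0 \<le> \<rho> x * K x y" "variance_on S \<rho> F > 0"
  shows "spectral_gap S \<rho> K \<le> dirichlet_form S \<rho> K F / variance_on S \<rho> F"
  unfolding spectral_gap_def
proof (rule cInf_lower)
  have "0 \<le> dirichlet_form S \<rho> K f" for f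
    by (auto simp: dirichlet_form_def intro!: sum_nonneg mult_nonneg_nonneg[OF assms(1)])
  then show "bdd_below {dirichlet_form S \<rho> K f / variance_on S \<rho> f |f. variance_on S \<rho> f > 0}"
    by (intro bdd_belowI[of _ 0]) auto
qed (use assms in blast)

theorem theorem5p1:
  fixes p :: "'a::finite \<Rightarrow> 'a \<Rightarrow> real" and \<pi> :: "'a \<Rightarrow> real"
    and l :: real and n :: nat
  assumes "CARD('a) \<ge> 2"
    and "markov_kernel p"
    and "irreducible_kernel p"
    and "stationary_distribution \<pi> p"
    and "reversible_kernel \<pi> p"
    and "kernel_eigenvalue p l"
    and "-1 < l" and "l < 1"
    and "n \<ge> 2"
  shows "spectral_gap (count_space_pos \<pi> p n) (count_law \<pi> p n) (count_kernel \<pi> p n)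
    \<le> (1 - l ^ n) / (real n * ((1 + l) / (1 - l)) - 2 * l * (1 - l ^ n) / (1 - l)\<^sup>2)"
proof -
  obtain f x\<^sub>0 where f: "kernel_op p f = (\<lambda>x. l * f x)" and fx: "f x\<^sub>0 \<noteq> 0"
    using assms(6) by (auto simp: kernel_eigenvalue_def fun_eq_iff)
  obtain m where n: "n = Suc m" using assms(9) by (cases n) auto
  have l: "l \<noteq> 1" using assms by simp
  note stat = assms(2,4)
  let ?S = "count_space_pos \<pi> p n" and ?\<rho> = "count_law \<pi> p n" and ?K = "count_kernel \<pi> p n"
  define \<sigma> where "\<sigma> = (\<Sum>x\<in>UNIV. \<pi> x * (f x)\<^sup>2)"
  define F where "F = (\<lambda>\<eta>. \<Sum>x\<in>UNIV. real (\<eta> x) * f x)"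
  have F: "F (counts u) = sum_list (map f u)" for u
    by (simp add: F_def sum_list_map_counts)
  \<comment> \<open>The eigenfunction is only known to be nonzero at one state, so \<pi> has to
    charge that state.\<close>
  have pos: "0 < \<pi> x" for x by (rule stationary_pos[OF assms(2-4)])
  have \<sigma>: "0 < \<sigma>"
    unfolding \<sigma>_def
    using fx by (intro sum_pos2[of _ x\<^sub>0]) (simp_all add: pos less_imp_le)
  have mean: "mean_on ?S ?\<rho> F = 0"
  proof -
    have "mean_on ?S ?\<rho> F = (\<Sum>x\<in>UNIV. \<pi> x * ((\<Sum>k\<le>m. l ^ k) * f x))"
      unfolding mean_on_def count_law_sum[OF stat] F n path_law_sum
        walk_mean_sum_eigen[OF assms(2) f] ..
    also have "\<dots> = (\<Sum>k\<le>m. l ^ k) * (\<Sum>x\<in>UNIV. \<pi> x * f x)"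
      by (simp add: sum_distrib_left mult_ac)
    finally show ?thesis by (simp add: stationary_eigen_mean[OF assms(4) f l])
  qed
  have var: "variance_on ?S ?\<rho> F = variance_factor l n * \<sigma>"
    unfolding variance_on_def mean diff_zero count_law_sum[OF stat] F
    unfolding n path_law_sum \<sigma>_def by (rule stationary_walk_sum_square[OF stat f l])
  have var_pos: "0 < variance_on ?S ?\<rho> F"
    unfolding var using assms \<sigma> by (simp add: variance_factor_pos)
  \<comment> \<open>For each fixed \<eta>, the nonnegative function is the squared increment of
    \<open>F\<close> from \<eta>.\<close>
  have "dirichlet_form ?S ?\<rho> ?K F \<le> 1/2 * (\<Sum>\<eta>\<in>?S. \<Sum>u\<in>windows_with_counts n \<eta>.
      path_law \<pi> p u * (\<Sum>z\<in>UNIV. p (last u) z *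
        (F (\<lambda>y. \<eta> y - unit_count (hd u) y + unit_count z y) - F \<eta>)\<^sup>2))"
    unfolding dirichlet_form_def
    by (intro mult_left_mono sum_mono
        count_law_times_kernel_le[where g = "\<lambda>\<xi>. (F \<xi> - F _)\<^sup>2", OF stat finite_count_space_pos]) auto
  also have "\<dots> = 1/2 * (\<Sum>\<eta>\<in>?S. \<Sum>u\<in>windows_with_counts n \<eta>.
      path_law \<pi> p u * (\<Sum>z\<in>UNIV. p (last u) z * (f z - f (hd u))\<^sup>2))"
  proof (intro arg_cong[where f = "\<lambda>t. 1/2 * t"] sum.cong refl)
    fix \<eta> :: "'a \<Rightarrow> nat" and u assume "u \<in> windows_with_counts n \<eta>"
    then have "\<eta> = counts u" "u \<noteq> []" using n by (auto simp: windows_with_counts_def)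
    then have "F (\<lambda>y. \<eta> y - unit_count (hd u) y + unit_count z y) - F \<eta> = f z - f (hd u)" for z
      using sum_slide[of u z f] F[of u] by (simp add: F_def)
    then show "path_law \<pi> p u * (\<Sum>z\<in>UNIV. p (last u) z *
        (F (\<lambda>y. \<eta> y - unit_count (hd u) y + unit_count z y) - F \<eta>)\<^sup>2)
      = path_law \<pi> p u * (\<Sum>z\<in>UNIV. p (last u) z * (f z - f (hd u))\<^sup>2)" by simp
  qed
  \<comment> \<open>Enlarging to all attained counts lets the fibres of \<open>counts\<close>
    combine into a sum over all windows of length \<open>n\<close>.\<close>
  also have "\<dots> \<le> 1/2 * (\<Sum>\<eta>\<in>counts ` {u. length u = n}. \<Sum>u\<in>windows_with_counts n \<eta>.
      path_law \<pi> p u * (\<Sum>z\<in>UNIV. p (last u) z * (f z - f (hd u))\<^sup>2))"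
    using assms(2)
    by (intro mult_left_mono sum_mono2 count_space_pos_subset finite_imageI finite_length_eq
        sum_nonneg mult_nonneg_nonneg path_law_nonneg stat) (auto simp: markov_kernel_def)
  also have "\<dots> = (1 - l ^ n) * \<sigma>"
    unfolding sum_windows unfolding n stationary_square_diff[OF stat f] \<sigma>_def by simp
  finally have dir: "dirichlet_form ?S ?\<rho> ?K F \<le> (1 - l ^ n) * \<sigma>" .
  have "0 \<le> ?\<rho> \<eta> * ?K \<eta> \<xi>" for \<eta> \<xi>
    using assms(2) unfolding count_kernel_def
    by (intro mult_nonneg_nonneg sum_nonneg path_law_nonneg count_law_nonneg stat)
       (auto simp: markov_kernel_def count_law_nonneg[OF stat])
  then have "spectral_gap ?S ?\<rho> ?K \<le> dirichlet_form ?S ?\<rho> ?K F / variance_on ?S ?\<rho> F"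
    by (intro spectral_gap_le var_pos)
  also have "\<dots> \<le> (1 - l ^ n) * \<sigma> / (variance_factor l n * \<sigma>)"
    using dir var_pos unfolding var by (intro divide_right_mono) auto
  also have "\<dots> = (1 - l ^ n) / variance_factor l n" using \<sigma> by simp
  finally show ?thesis unfolding variance_factor_def .
qed

end
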